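(* Let $r>1$ be a real number and let $$x = 4 \left( \left(\lambda^{\ast}(r)\right)^2 - \left(\lambda^{\ast}(r)\right)^4\right).$$ Set $$z = -\frac{27 x}{(1-4 x)^3}, \qquad a = \frac{2 (1-4x)\, \alpha (r)+ \left(4x-1+ \sqrt{1-x}\right) \sqrt{r}}{2\sqrt{(1-4x)^{3}}}, \qquad b = \frac{(1+8x) \sqrt{1-x}\, \sqrt{r}}{\sqrt{(1-4x)^{3}}}.$$ If $|z|<1$, then $$\frac{1}{\pi} = \sum_{n = 0}^{\infty} \frac{ \left( \frac{1}{6} \right)_{n} \left( \frac{1}{2} \right)_{n} \left( \frac{5}{6} \right)_{n} }{ \left( n! \right)^3} z^{n} (a+bn).$$
   Context: $(c)_n = c(c+1)\cdots(c+n-1)$ denotes the Pochhammer symbol, with $(c)_0=1$. For $0\le k<1$, the complete elliptic integrals of the first and second kinds with modulus $k$ are $$\mathbf{K}(k) = \int_{0}^{\pi/2} \frac{d\theta}{\sqrt{1 - k^2 \sin^2 \theta}}, \qquad \mathbf{E}(k) = \int_{0}^{\pi/2} \sqrt{1 - k^2 \sin^2 \theta}\, d\theta,$$ and for $0<k<1$, $\mathbf{K}'(k) = \mathbf{K}(\sqrt{1-k^2})$. For $r>0$, the elliptic lambda function $\lambda^{\ast}(r)$ is the unique $k_r\in(0,1)$ such that $\mathbf{K}'(k_r)/\mathbf{K}(k_r)=\sqrt{r}$. The elliptic alpha function is $$\alpha(r) = \frac{\pi}{4 \mathbf{K}(k_r)^{2}} - \sqrt{r} \left( \frac{\mathbf{E}(k_r)}{\mathbf{K}(k_r)}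 - 1 \right), \qquad k_r=\lambda^{\ast}(r).$$ *)

theory Defs
  imports "HOL-Analysis.Analysis"
begin

text \<open>The argument of the elliptic integrals is the modulus \<open>k\<close>, not the parameter \<open>m = k\<^sup>2\<close>.
  The definitions are meaningful for \<open>0 \<le> k < 1\<close>.\<close>

definition ellK :: "real \<Rightarrow> real" where
  "ellK k = integral {0..pi/2} (\<lambda>\<theta>. 1 / sqrt (1 - k\<^sup>2 * (sin \<theta>)\<^sup>2))"

definition ellE :: "real \<Rightarrow> real" where
  "ellE k = integral {0..pi/2} (\<lambda>\<theta>. sqrt (1 - k\<^sup>2 * (sin \<theta>)\<^sup>2))"

definition ellK' :: "real \<Rightarrow> real" where
  "ellK' k = ellK (sqrt (1 - k\<^sup>2))"

definition lambda_star :: "real \<Rightarrow> real" where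
  "lambda_star r = (THE k. 0 < k \<and> k < 1 \<and> ellK' k / ellK k = sqrt r)"

definition elliptic_alpha :: "real \<Rightarrow> real" where
  "elliptic_alpha r =
     (let k = lambda_star r
      in pi / (4 * (ellK k)\<^sup>2) - sqrt r * (ellE k / ellK k - 1))"

end

(* Put m = k^2, so that x = 4 m (1 - m), and let u = 2F1(1/12, 5/12; 1; .). By Clausen's formula the
   series with a = 1, b = 0 is u(z)^2. Both K and (1 - 4 x)^(-1/4) u(z) solve (m (1 - m) y')' = y / 4
   and are regular at m = 0, hence 2 K / pi = (1 - 4 x)^(-1/4) u(z). This and its derivative, which is
   linear in K and E, express the series through K and E; in the given combination the value of
   alpha(r) makes everything except 1 / pi cancel. The equation K'/K = sqrt r enters only through
   k < 1 / sqrt 2. The condition \<bar>z\<bar> < 1 forces x < 1/4, and then it holds on the whole path from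
   m = 0. *)
theory Submission
  imports Defs "HOL-Real_Asymp.Real_Asymp"
begin

unbundle no vec_syntax
unbundle fps_syntax

section \<open>The hypergeometric series and Clausen's formula\<close>

text \<open>The obstacle is that m = 0 is a singular point of the equation, so the uniqueness
  theorem for initial value problems does not apply there. What replaces it is the quantity m (1 -
  m) y', which for both solutions extends continuously by 0 to m = 0, although the closed formula
  for the derivative of K is 0/0 at that point. The algebra rests on one factorisation, (1 - 4 x)^3
  + 27 x = (1 - x) (1 + 8 x)^2, which gives 1 - z = (1 - x) (1 + 8 x)^2 / (1 - 4 x)^3. It makes the
  substitution of z carry one hypergeometric equation into another, and it also excludes x > 1/4.
  The factor (1 + 8 x) sqrt (1 - x) in b comes from dz/dm: dz/dx is a multiple of 1 + 8 x, and dx/dm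
  = 4 (1 - 2 m) = 4 sqrt (1 - x).\<close>

definition hyp21_fps :: "real \<Rightarrow> real \<Rightarrow> real fps" where
  "hyp21_fps a b = Abs_fps (\<lambda>n. pochhammer a n * pochhammer b n / (fact n)\<^sup>2)"

text \<open>Euler's operator. It is diagonal on the powers of the variable, so a differential
  equation written with it can be read directly as a recurrence for the coefficients.\<close>

definition fps_theta :: "'a::comm_ring_1 fps \<Rightarrow> 'a fps" where
  "fps_theta f = fps_X * fps_deriv f"

lemma fps_theta_nth [simp]: "fps_theta f $ n = of_nat n * f $ n"
  by (cases n) (simp_all add: fps_theta_def)

lemma fps_theta_add: "fps_theta (f + g) = fps_theta f + fps_theta g"
  by (simp add: fps_theta_def algebra_simps)

lemma fps_theta_diff: "fps_theta (f - g) = fps_theta f - fps_theta g"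
  by (simp add: fps_theta_def algebra_simps)

lemma fps_theta_mult: "fps_theta (f * g) = fps_theta f * g + f * fps_theta g"
  by (simp add: fps_theta_def algebra_simps)

lemma fps_theta_const [simp]: "fps_theta (fps_const c) = 0"
  by (simp add: fps_theta_def)

lemma fps_theta_X [simp]: "fps_theta fps_X = fps_X"
  by (simp add: fps_theta_def)

lemma hyp21_fps_nth_Suc:
  "(real n + 1)\<^sup>2 * hyp21_fps a b $ Suc n = (real n + a) * (real n + b) * hyp21_fps a b $ n"
proof -
  have "real n + 1 \<noteq> 0" by linarith
  then show ?thesis
    by (simp add: hyp21_fps_def pochhammer_Suc fact_Suc power_mult_distrib add_ac mult_ac)
qed

lemma hyp21_fps_theta:
  fixes a b :: real
  defines "u \<equiv> hyp21_fps a b"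
  shows "fps_theta (fps_theta u) =
    fps_X * (fps_theta (fps_theta u) + fps_const (a + b) * fps_theta u + fps_const (a * b) * u)"
proof (rule fps_ext)
  fix n
  show "fps_theta (fps_theta u) $ n =
    (fps_X * (fps_theta (fps_theta u) + fps_const (a + b) * fps_theta u + fps_const (a * b) * u)) $ n"
    using hyp21_fps_nth_Suc[of "n - 1" a b]
    by (cases n) (simp_all add: u_def power2_eq_square algebra_simps)
qed

text \<open>The coefficient recurrence once more, now in ordinary derivatives: this is the form that
  gets evaluated at a real point and combined with the chain rule.\<close>

lemma hyp21_fps_deriv:
  fixes a b :: real
  defines "u \<equiv> hyp21_fps a b"
  shows "fps_X * (1 - fps_X) * fps_deriv (fps_deriv u)
    + (1 - fps_const (a + b + 1) * fps_X) * fps_deriv u = fps_const (a * b) * u"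
proof (rule fps_ext)
  fix n
  have "fps_X * (1 - fps_X) * fps_deriv (fps_deriv u)
      + (1 - fps_const (a + b + 1) * fps_X) * fps_deriv u
    = fps_X * fps_deriv (fps_deriv u) + fps_deriv u
      - fps_X * (fps_X * fps_deriv (fps_deriv u)) - fps_const (a + b + 1) * (fps_X * fps_deriv u)"
    by (simp add: algebra_simps)
  also have "\<dots> $ n = (fps_const (a * b) * u) $ n"
    using hyp21_fps_nth_Suc[of n a b]
    by (cases n) (simp_all add: u_def power2_eq_square algebra_simps)
  finally show "(fps_X * (1 - fps_X) * fps_deriv (fps_deriv u)
    + (1 - fps_const (a + b + 1) * fps_X) * fps_deriv u) $ n = (fps_const (a * b) * u) $ n" .
qed

lemma hyp21_fps_conv_radius:
  assumes "a > 0" "b > 0"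
  shows "fps_conv_radius (hyp21_fps a b) = 1"
  unfolding fps_conv_radius_def
proof (rule conv_radius_ratio_limit_nonzero[where c = 1])
  let ?u = "hyp21_fps a b"
  have pos: "?u $ n > 0" for n
    using assms by (auto simp: hyp21_fps_def intro!: divide_pos_pos mult_pos_pos pochhammer_pos)
  have "norm (?u $ n) / norm (?u $ Suc n) = (real n + 1)\<^sup>2 / ((real n + a) * (real n + b))" for n
  proof -
    have "(real n + a) * (real n + b) \<noteq> 0"
      using assms by (simp add: add_nonneg_pos order_less_imp_not_eq2)
    then show ?thesis
      using hyp21_fps_nth_Suc[of n a b] pos[of n] pos[of "Suc n"]
      by (simp add: frac_eq_eq mult_ac)
  qed
  moreover have "(\<lambda>n. (real n + 1)\<^sup>2 / ((real n + a) * (real n + b))) \<longlonglongrightarrow> 1"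
    by real_asymp
  ultimately show "(\<lambda>n. norm (?u $ n) / norm (?u $ Suc n)) \<longlonglongrightarrow> 1"
    by simp
qed auto

text \<open>Put v = u^2 and let w be the square of \<open>fps_theta u\<close>. The equation of u
  gives \<open>tw\<close> for the derivative of w, and \<open>e1\<close> for w in terms of v.
  Applying the operator to \<open>e1\<close> and inserting \<open>tw\<close> would in general leave
  w with the factor 2 X (2 (a + b) - 1); for a + b = 1/2 it disappears, and the third-order equation
  \<open>e3\<close> for v alone is a two-term recurrence.\<close>

lemma hyp21_clausen:
  fixes a b :: real
  assumes "a + b = 1/2"
  shows "hyp21_fps a b * hyp21_fps a b =
    Abs_fps (\<lambda>n. pochhammer (2*a) n * pochhammer (1/2) n * pochhammer (2*b) n / (fact n)^3)"
proof -
  let ?t = "fps_theta :: real fps \<Rightarrow> real fps"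
  let ?h = "fps_const (1/2) :: real fps" and ?c = "fps_const (a * b)"
  define u where "u = hyp21_fps a b"
  define v where "v = u * u"
  define w where "w = ?t u * ?t u"
  let ?X = "fps_X :: real fps"
  have c2: "fps_const 2 = (2 :: real fps)"
    by (simp add: numeral_fps_const)
  have hh: "2 * ?h = 1"
    by (simp add: numeral_fps_const flip: fps_const_mult)
  have ode: "?t (?t u) = ?X * (?t (?t u) + ?h * ?t u + ?c * u)"
    using hyp21_fps_theta[of a b] assms by (simp add: u_def)
  have t1: "?t 1 = 0" and t2: "?t 2 = 0"
    by (simp_all add: fps_theta_def)
  have v1: "?t v = 2 * u * ?t u"
    by (simp add: v_def fps_theta_mult)
  have v2: "?t (?t v) = 2 * w + 2 * u * ?t (?t u)"
    by (simp add: v1 w_def fps_theta_mult t2 algebra_simps)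
  have tw: "(1 - ?X) * ?t w = ?X * (w + ?c * ?t v)"
  proof -
    have "(1 - ?X) * ?t w = 2 * ?t u * (?t (?t u) - ?X * ?t (?t u))"
      by (simp add: w_def fps_theta_mult algebra_simps)
    also have "?t (?t u) - ?X * ?t (?t u) = ?X * (?h * ?t u + ?c * u)"
      by (subst ode) (simp add: algebra_simps)
    also have "2 * ?t u * (?X * (?h * ?t u + ?c * u)) = ?X * ((2 * ?h) * w + ?c * ?t v)"
      by (simp add: v1 w_def algebra_simps)
    finally show ?thesis by (simp only: hh mult_1)
  qed
  have e1: "2 * (1 - ?X) * w = (1 - ?X) * ?t (?t v) - ?X * (?h * ?t v + 2 * ?c * v)"
  proof -
    have "(1 - ?X) * ?t (?t v) - 2 * (1 - ?X) * w = 2 * u * (?t (?t u) - ?X * ?t (?t u))"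
      by (simp add: v2 algebra_simps)
    also have "?t (?t u) - ?X * ?t (?t u) = ?X * (?h * ?t u + ?c * u)"
      by (subst ode) (simp add: algebra_simps)
    also have "2 * u * (?X * (?h * ?t u + ?c * u)) = ?X * (?h * ?t v + 2 * ?c * v)"
      unfolding v1 by (simp add: v_def algebra_simps)
    finally show ?thesis by (simp add: algebra_simps)
  qed
  have e2: "2 * ((1 - ?X) * ?t w) - 2 * ?X * w
     = (1 - ?X) * ?t (?t (?t v)) - ?X * ?t (?t v)
       - ?X * (?h * ?t v + 2 * ?c * v) - ?X * (?h * ?t (?t v) + 2 * ?c * ?t v)"
    using arg_cong[OF e1, of ?t]
    by (simp add: fps_theta_mult fps_theta_add fps_theta_diff t1 t2 algebra_simps)
  have e3: "?t (?t (?t v)) = ?X * (?t (?t (?t v)) + ?t (?t v) + ?h * ?t (?t v) + ?h * ?t v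
       + 4 * ?c * ?t v + 2 * ?c * v)"
    using e2 unfolding tw by (simp add: algebra_simps)
  have c4: "fps_const 4 = (4 :: real fps)"
    by (simp add: numeral_fps_const)
  have rec: "(real n + 1)^3 * v $ Suc n
      = (real n + 2*a) * (real n + 1/2) * (real n + 2*b) * v $ n" for n
  proof -
    have ab: "a = 1/2 - b" using assms by simp
    have "?t (?t (?t v)) $ Suc n = (?t (?t (?t v)) + ?t (?t v) + ?h * ?t (?t v) + ?h * ?t v
       + fps_const 4 * (?c * ?t v) + fps_const 2 * (?c * v)) $ n"
      by (subst e3) (simp add: c2 c4 mult.assoc)
    thus ?thesis
      unfolding ab by (simp add: power3_eq_cube algebra_simps add_divide_distrib)
  qed
  have "v $ n = pochhammer (2*a) n * pochhammer (1/2) n * pochhammer (2*b) n / (fact n)^3" for n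
  proof (induction n)
    case 0
    show ?case by (simp add: v_def u_def hyp21_fps_def)
  next
    case (Suc n)
    have "v $ Suc n = (real n + 2*a) * (real n + 1/2) * (real n + 2*b) * v $ n / (real n + 1)^3"
      using rec[of n] by (simp add: field_simps)
    also have "\<dots> = pochhammer (2*a) (Suc n) * pochhammer (1/2) (Suc n) * pochhammer (2*b) (Suc n)
        / (fact (Suc n))^3"
      unfolding Suc.IH pochhammer_Suc fact_Suc
      by (simp add: power_mult_distrib add_ac mult_ac)
    finally show ?case .
  qed
  thus ?thesis
    unfolding v_def u_def by (intro fps_ext) simp
qed

section \<open>Complete elliptic integrals as functions of the parameter\<close>

definition parK :: "real \<Rightarrow> real" where
  "parK m = integral {0..pi/2} (\<lambda>\<theta>. 1 / sqrt (1 - m * (sin \<theta>)\<^sup>2))"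

definition parE :: "real \<Rightarrow> real" where
  "parE m = integral {0..pi/2} (\<lambda>\<theta>. sqrt (1 - m * (sin \<theta>)\<^sup>2))"

lemma Delta_pos:
  fixes m \<theta> :: real
  assumes "m < 1"
  shows "1 - m * (sin \<theta>)\<^sup>2 > 0"
proof (cases "m \<le> 0")
  case True
  then have "m * (sin \<theta>)\<^sup>2 \<le> 0" by (simp add: mult_nonpos_nonneg)
  then show ?thesis by simp
next
  case False
  then have "m * (sin \<theta>)\<^sup>2 \<le> m * 1"
    by (intro mult_left_mono) (auto simp: abs_square_le_1)
  with assms show ?thesis by simp
qed

lemma Delta_nz [simp]: "m < 1 \<Longrightarrow> 1 - m * (sin (\<theta>::real))\<^sup>2 \<noteq> 0"
  using Delta_pos[of m \<theta>] by simp

lemma Delta_integrable: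
  assumes "m < 1"
  shows "(\<lambda>\<theta>. 1 / sqrt (1 - m * (sin \<theta>)\<^sup>2)) integrable_on {0..pi/2}"
    and "(\<lambda>\<theta>. sqrt (1 - m * (sin \<theta>)\<^sup>2)) integrable_on {0..pi/2}"
    and "(\<lambda>\<theta>. 1 / (sqrt (1 - m * (sin \<theta>)\<^sup>2))^3) integrable_on {0..pi/2}"
    and "(\<lambda>\<theta>. (sin \<theta>)\<^sup>2 / (2 * (sqrt (1 - m * (sin \<theta>)\<^sup>2))^3)) integrable_on {0..pi/2}"
  using Delta_nz[OF assms] by (auto intro!: integrable_continuous_interval continuous_intros)

lemma parK_0 [simp]: "parK 0 = pi/2" and parE_0 [simp]: "parE 0 = pi/2"
  by (simp_all add: parK_def parE_def)

text \<open>Differentiation under the integral sign. Unlike the closed form in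
  \<open>parK_deriv\<close>, this one covers m = 0, where it supplies continuity, and its integrand
  is visibly nonnegative, which gives monotonicity.\<close>

lemma parK_deriv_integral:
  assumes "m < 1"
  shows "(parK has_real_derivative
     integral {0..pi/2} (\<lambda>\<theta>. (sin \<theta>)\<^sup>2 / (2 * (sqrt (1 - m * (sin \<theta>)\<^sup>2))^3))) (at m)"
proof -
  have "((\<lambda>m. integral (cbox 0 (pi/2)) (\<lambda>\<theta>. 1 / sqrt (1 - m * (sin \<theta>)\<^sup>2))) has_real_derivative
     integral (cbox 0 (pi/2)) (\<lambda>\<theta>. (sin \<theta>)\<^sup>2 / (2 * (sqrt (1 - m * (sin \<theta>)\<^sup>2))^3)))
     (at m within {..<1})"
  proof (rule leibniz_rule_field_derivative)
    fix x t :: real assume "x \<in> {..<1}"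
    then have p: "1 - x * (sin t)\<^sup>2 > 0" using Delta_pos by simp
    show "((\<lambda>x. 1 / sqrt (1 - x * (sin t)\<^sup>2)) has_real_derivative
        (sin t)\<^sup>2 / (2 * sqrt (1 - x * (sin t)\<^sup>2) ^ 3)) (at x within {..<1})"
      using p by (auto intro!: derivative_eq_intros simp: field_simps power3_eq_cube)
  next
    fix x :: real assume "x \<in> {..<1}"
    then show "(\<lambda>\<theta>. 1 / sqrt (1 - x * (sin \<theta>)\<^sup>2)) integrable_on cbox 0 (pi/2)"
      using Delta_integrable(1)[of x] by simp
  next
    show "continuous_on ({..<1} \<times> cbox 0 (pi/2))
        (\<lambda>(x, t). (sin t)\<^sup>2 / (2 * sqrt (1 - x * (sin t)\<^sup>2) ^ 3))"
      unfolding split_beta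
      using Delta_nz by (auto intro!: continuous_intros)
  qed (use assms in auto)
  then show ?thesis
    using assms by (simp add: parK_def[abs_def] at_within_open[of m "{..<1}"])
qed

lemma parE_deriv_integral:
  assumes "m < 1"
  shows "(parE has_real_derivative
     integral {0..pi/2} (\<lambda>\<theta>. - (sin \<theta>)\<^sup>2 / (2 * sqrt (1 - m * (sin \<theta>)\<^sup>2)))) (at m)"
proof -
  have "((\<lambda>m. integral (cbox 0 (pi/2)) (\<lambda>\<theta>. sqrt (1 - m * (sin \<theta>)\<^sup>2))) has_real_derivative
     integral (cbox 0 (pi/2)) (\<lambda>\<theta>. - (sin \<theta>)\<^sup>2 / (2 * sqrt (1 - m * (sin \<theta>)\<^sup>2))))
     (at m within {..<1})"
  proof (rule leibniz_rule_field_derivative)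
    fix x t :: real assume "x \<in> {..<1}"
    then have p: "1 - x * (sin t)\<^sup>2 > 0" using Delta_pos by simp
    show "((\<lambda>x. sqrt (1 - x * (sin t)\<^sup>2)) has_real_derivative
        - (sin t)\<^sup>2 / (2 * sqrt (1 - x * (sin t)\<^sup>2))) (at x within {..<1})"
      using p by (auto intro!: derivative_eq_intros simp: field_simps)
  next
    fix x :: real assume "x \<in> {..<1}"
    then show "(\<lambda>\<theta>. sqrt (1 - x * (sin \<theta>)\<^sup>2)) integrable_on cbox 0 (pi/2)"
      using Delta_integrable(2)[of x] by simp
  next
    show "continuous_on ({..<1} \<times> cbox 0 (pi/2))
        (\<lambda>(x, t). - (sin t)\<^sup>2 / (2 * sqrt (1 - x * (sin t)\<^sup>2)))"
      unfolding split_beta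
      using Delta_nz by (auto intro!: continuous_intros)
  qed (use assms in auto)
  then show ?thesis
    using assms by (simp add: parE_def[abs_def] at_within_open[of m "{..<1}"])
qed

lemma parE_deriv:
  assumes "m < 1" "m \<noteq> 0"
  shows "(parE has_real_derivative (parE m - parK m) / (2 * m)) (at m)"
proof -
  have "(\<lambda>\<theta>. - (sin \<theta>)\<^sup>2 / (2 * sqrt (1 - m * (sin \<theta>)\<^sup>2)))
    = (\<lambda>\<theta>. (sqrt (1 - m * (sin \<theta>)\<^sup>2) - 1 / sqrt (1 - m * (sin \<theta>)\<^sup>2)) / (2 * m))"
  proof
    fix \<theta> :: real
    let ?D = "sqrt (1 - m * (sin \<theta>)\<^sup>2)"
    have D: "?D > 0" "m * (sin \<theta>)\<^sup>2 = 1 - ?D * ?D"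
      using Delta_pos[OF assms(1), of \<theta>] by simp_all
    show "- (sin \<theta>)\<^sup>2 / (2 * ?D) = (?D - 1 / ?D) / (2 * m)"
      using D assms(2) by (simp add: divide_simps algebra_simps)
  qed
  then have "integral {0..pi/2} (\<lambda>\<theta>. - (sin \<theta>)\<^sup>2 / (2 * sqrt (1 - m * (sin \<theta>)\<^sup>2)))
      = (parE m - parK m) / (2 * m)"
    using Delta_integrable[OF assms(1)]
    by (simp add: parK_def parE_def integral_diff)
  then show ?thesis
    using parE_deriv_integral[OF assms(1)] by simp
qed

text \<open>The boundary terms of \<open>m sin \<theta> cos \<theta> / \<Delta>\<close> vanish, and its derivative is
  \<open>\<Delta> - (1 - m) / \<Delta>\<^sup>3\<close>.\<close>
lemma integral_Delta_cubed:
  assumes "m < 1"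
  shows "integral {0..pi/2} (\<lambda>\<theta>. 1 / (sqrt (1 - m * (sin \<theta>)\<^sup>2))^3) = parE m / (1 - m)"
proof -
  let ?D = "\<lambda>\<theta>. sqrt (1 - m * (sin \<theta>)\<^sup>2)"
  have "((\<lambda>\<theta>. ?D \<theta> - (1 - m) * (1 / ?D \<theta> ^ 3)) has_integral
     (m * sin (pi/2) * cos (pi/2) / ?D (pi/2) - m * sin 0 * cos 0 / ?D 0)) {0..pi/2}"
  proof (rule fundamental_theorem_of_calculus)
    fix \<theta> :: real
    have D: "?D \<theta> > 0" and D2: "?D \<theta> ^ 2 = 1 - m * (sin \<theta>)\<^sup>2"
      using Delta_pos[OF assms, of \<theta>] by simp_all
    have "((\<lambda>\<theta>. m * sin \<theta> * cos \<theta> / ?D \<theta>) has_real_derivative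
       (m * ((cos \<theta>)\<^sup>2 - (sin \<theta>)\<^sup>2) * ?D \<theta>
          + m * sin \<theta> * cos \<theta> * (m * sin \<theta> * cos \<theta> / ?D \<theta>)) / (?D \<theta>)^2) (at \<theta> within {0..pi/2})"
      using D by (auto intro!: derivative_eq_intros simp: divide_simps power2_eq_square)
        (simp_all add: algebra_simps)
    also have "(m * ((cos \<theta>)\<^sup>2 - (sin \<theta>)\<^sup>2) * ?D \<theta>
          + m * sin \<theta> * cos \<theta> * (m * sin \<theta> * cos \<theta> / ?D \<theta>)) / (?D \<theta>)^2
        = (m * ((cos \<theta>)\<^sup>2 - (sin \<theta>)\<^sup>2) * ?D \<theta> ^ 2 + m\<^sup>2 * (sin \<theta>)\<^sup>2 * (cos \<theta>)\<^sup>2) / ?D \<theta> ^ 3"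
      using D by (simp add: field_simps power2_eq_square power3_eq_cube)
    also have "m * ((cos \<theta>)\<^sup>2 - (sin \<theta>)\<^sup>2) * ?D \<theta> ^ 2 + m\<^sup>2 * (sin \<theta>)\<^sup>2 * (cos \<theta>)\<^sup>2
        = ?D \<theta> ^ 2 * ?D \<theta> ^ 2 - (1 - m)"
      unfolding D2 cos_squared_eq by (simp add: algebra_simps power2_eq_square)
    also have "(?D \<theta> ^ 2 * ?D \<theta> ^ 2 - (1 - m)) / ?D \<theta> ^ 3 = ?D \<theta> - (1 - m) * (1 / ?D \<theta> ^ 3)"
      using D by (simp add: divide_simps power2_eq_square power3_eq_cube)
    finally show "((\<lambda>\<theta>. m * sin \<theta> * cos \<theta> / ?D \<theta>) has_vector_derivative
        ?D \<theta> - (1 - m) * (1 / ?D \<theta> ^ 3)) (at \<theta> within {0..pi/2})"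
      by (simp add: has_real_derivative_iff_has_vector_derivative)
  qed simp
  then have "integral {0..pi/2} (\<lambda>\<theta>. ?D \<theta> - (1 - m) * (1 / ?D \<theta> ^ 3)) = 0"
    by (simp add: integral_unique)
  moreover have "integral {0..pi/2} (\<lambda>\<theta>. ?D \<theta> - (1 - m) * (1 / ?D \<theta> ^ 3))
     = parE m - (1 - m) * integral {0..pi/2} (\<lambda>\<theta>. 1 / ?D \<theta> ^ 3)"
    using Delta_integrable(2,3)[OF assms] integrable_on_mult_right[OF Delta_integrable(3)[OF assms], of "1 - m"]
    by (subst integral_diff) (auto simp: parE_def simp del: times_divide_eq_right)
  ultimately show ?thesis
    using assms by (simp add: field_simps)
qed

text \<open>With \<Delta> the square root in the integrand, m sin^2 \<theta> = 1 - \<Delta>^2 splits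
  the integrand of the derivative into 1/\<Delta>^3 and 1/\<Delta>; the first is
  \<open>integral_Delta_cubed\<close>.\<close>

lemma parK_deriv:
  assumes "m < 1" "m \<noteq> 0"
  shows "(parK has_real_derivative (parE m - (1 - m) * parK m) / (2 * m * (1 - m))) (at m)"
proof -
  have "(\<lambda>\<theta>. (sin \<theta>)\<^sup>2 / (2 * (sqrt (1 - m * (sin \<theta>)\<^sup>2))^3))
    = (\<lambda>\<theta>. (1 / sqrt (1 - m * (sin \<theta>)\<^sup>2) ^ 3 - 1 / sqrt (1 - m * (sin \<theta>)\<^sup>2)) / (2 * m))"
  proof
    fix \<theta> :: real
    let ?D = "sqrt (1 - m * (sin \<theta>)\<^sup>2)"
    have D: "?D > 0" "m * (sin \<theta>)\<^sup>2 = 1 - ?D * ?D"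
      using Delta_pos[OF assms(1), of \<theta>] by simp_all
    have "s / (2 * d ^ 3) = (1 / d ^ 3 - 1 / d) / (2 * m)" if "d > 0" "m * s = 1 - d * d" for s d
    proof -
      have "s = (1 - d * d) / m" using that assms(2) by (simp add: field_simps)
      then show ?thesis
        using that(1) assms(2) by (simp add: field_simps power3_eq_cube)
    qed
    from this[OF D] show "(sin \<theta>)\<^sup>2 / (2 * ?D ^ 3) = (1 / ?D ^ 3 - 1 / ?D) / (2 * m)" .
  qed
  then have "integral {0..pi/2} (\<lambda>\<theta>. (sin \<theta>)\<^sup>2 / (2 * (sqrt (1 - m * (sin \<theta>)\<^sup>2))^3))
      = (parE m / (1 - m) - parK m) / (2 * m)"
    using Delta_integrable[OF assms(1)] integral_Delta_cubed[OF assms(1)]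
    by (simp add: parK_def integral_diff)
  also have "\<dots> = (parE m - (1 - m) * parK m) / (2 * m * (1 - m))"
    using assms by (simp add: field_simps)
  finally show ?thesis
    using parK_deriv_integral[OF assms(1)] by simp
qed

section \<open>Monotonicity of K, its growth near m = 1, and inversion of K'/K\<close>

lemma parK_mono:
  assumes "m \<le> n" "n < 1"
  shows "parK m \<le> parK n"
  unfolding parK_def
proof (rule integral_le)
  fix \<theta> :: real
  have "m * (sin \<theta>)\<^sup>2 \<le> n * (sin \<theta>)\<^sup>2"
    using assms by (intro mult_right_mono) auto
  then show "1 / sqrt (1 - m * (sin \<theta>)\<^sup>2) \<le> 1 / sqrt (1 - n * (sin \<theta>)\<^sup>2)"
    using Delta_pos[OF assms(2), of \<theta>] by (intro divide_left_mono) auto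
qed (use assms Delta_integrable(1) in auto)

lemma parK_ge:
  assumes "0 \<le> m" "m < 1"
  shows "parK m \<ge> pi / 2"
  using parK_mono[of 0 m] assms by simp

lemma parK_pos:
  assumes "0 \<le> m" "m < 1"
  shows "parK m > 0"
  using parK_ge[OF assms] pi_gt_zero by linarith

lemma parK_less:
  assumes "0 < m" "m < n" "n < 1"
  shows "parK m < parK n"
proof (rule DERIV_pos_imp_increasing[OF assms(2)])
  fix x assume x: "m \<le> x" "x \<le> n"
  let ?f = "\<lambda>\<theta>. (sin \<theta>)\<^sup>2 / (2 * (sqrt (1 - x * (sin \<theta>)\<^sup>2))^3)"
  have x1: "x < 1" using x assms by simp
  have nn: "?f \<theta> \<ge> 0" for \<theta>
    using Delta_pos[OF x1, of \<theta>] by simp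
  have "integral {0..pi/2} ?f \<noteq> 0"
  proof
    assume "integral {0..pi/2} ?f = 0"
    then have "\<forall>\<theta>\<in>{0..pi/2}. ?f \<theta> = 0"
      using Delta_nz[OF x1] nn
      by (subst (asm) integral_eq_0_iff) (auto intro!: continuous_intros)
    from bspec[OF this, of "pi/2"] show False using x1 by simp
  qed
  moreover have "integral {0..pi/2} ?f \<ge> 0"
    using Delta_integrable(4)[OF x1] nn by (intro integral_nonneg) auto
  ultimately show "\<exists>y. (parK has_real_derivative y) (at x) \<and> y > 0"
    using parK_deriv_integral[OF x1] by (intro exI[of _ "integral {0..pi/2} ?f"] conjI) simp_all
qed

text \<open>Since \<open>1 - m sin\<^sup>2 \<theta> = cos\<^sup>2 \<theta> + (1 - m) sin\<^sup>2 \<theta> \<le> (pi/2 - \<theta> + sqrt (1 - m))\<^sup>2\<close>,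
  the integral has a logarithmic lower bound.\<close>
lemma parK_ge_ln:
  assumes "0 < m" "m < 1"
  shows "parK m \<ge> ln ((pi/2 + sqrt (1 - m)) / sqrt (1 - m))"
proof -
  define k where "k = sqrt (1 - m)"
  have k: "k > 0" "k\<^sup>2 = 1 - m" using assms by (auto simp: k_def)
  have I: "((\<lambda>\<theta>. 1 / (pi/2 - \<theta> + k)) has_integral (- ln (pi/2 - pi/2 + k) - - ln (pi/2 - 0 + k)))
      {0..pi/2}"
    using k by (intro fundamental_theorem_of_calculus)
      (auto intro!: derivative_eq_intros simp: field_simps
        simp flip: has_real_derivative_iff_has_vector_derivative)
  have "- ln (pi/2 - pi/2 + k) - - ln (pi/2 - 0 + k) \<le> parK m"
    unfolding parK_def
  proof (rule has_integral_le[OF I integrable_integral[OF Delta_integrable(1)[OF assms(2)]]])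
    fix \<theta> assume t: "\<theta> \<in> {0..pi/2}"
    have s: "cos \<theta> = sin (pi/2 - \<theta>)" by (simp add: sin_cos_eq)
    have c: "cos \<theta> \<ge> 0" "cos \<theta> \<le> pi/2 - \<theta>"
      using t unfolding s by (auto intro!: sin_x_le_x sin_ge_zero)
    have "1 - m * (sin \<theta>)\<^sup>2 = (cos \<theta>)\<^sup>2 + k\<^sup>2 * (sin \<theta>)\<^sup>2"
      unfolding k cos_squared_eq by (simp add: algebra_simps)
    also have "\<dots> \<le> (pi/2 - \<theta>)\<^sup>2 + k\<^sup>2 * 1"
      using c by (intro add_mono power_mono mult_left_mono) (auto simp: abs_square_le_1)
    also have "\<dots> \<le> (pi/2 - \<theta> + k)\<^sup>2"
      using t k(1) by (simp add: power2_sum)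
    finally have "sqrt (1 - m * (sin \<theta>)\<^sup>2) \<le> pi/2 - \<theta> + k"
      using t k(1) by (intro real_le_lsqrt) auto
    then show "1 / (pi/2 - \<theta> + k) \<le> 1 / sqrt (1 - m * (sin \<theta>)\<^sup>2)"
      using Delta_pos[OF assms(2), of \<theta>] t k(1) by (intro divide_left_mono) auto
  qed
  then show ?thesis
    using k(1) unfolding k_def[symmetric] by (simp add: ln_div add_pos_pos order_less_imp_not_eq2)
qed

lemma ellK_parK: "ellK k = parK (k\<^sup>2)" and ellE_parE: "ellE k = parE (k\<^sup>2)"
  by (simp_all add: ellK_def ellE_def parK_def parE_def)

lemma ellK'_parK: "0 < k \<Longrightarrow> k < 1 \<Longrightarrow> ellK' k = parK (1 - k\<^sup>2)"
  by (simp add: ellK'_def ellK_parK abs_square_le_1)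

lemma parK_ratio_less:
  assumes "0 < m" "m < n" "n < 1"
  shows "parK (1 - n) / parK n < parK (1 - m) / parK m"
  using parK_less[of m n] parK_less[of "1 - n" "1 - m"] assms parK_pos[of m]
    parK_pos[of "1 - n"]
  by (intro frac_less) auto

text \<open>Intermediate value theorem: the ratio is 1 at m = 1/2 and unbounded near 0, where the
  numerator grows logarithmically. The denominator is at most \<open>parK (1/2)\<close> on (0, 1/2],
  so a point \<open>d\<close> whose logarithmic bound reaches \<open>s * parK (1/2)\<close> already
  has ratio at least \<open>s\<close>.\<close>

lemma parK_ratio_exists:
  assumes "s > 1"
  shows "\<exists>m. 0 < m \<and> m < 1/2 \<and> parK (1 - m) / parK m = s"
proof -
  let ?g = "\<lambda>m. parK (1 - m) / parK m"
  have cont: "isCont parK m" if "m < 1" for m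
    using parK_deriv_integral[OF that] by (rule DERIV_isCont)
  have "filterlim (\<lambda>m. ln ((pi/2 + sqrt m) / sqrt m)) at_top (at_right 0)"
    by real_asymp
  then have "eventually (\<lambda>m. ln ((pi/2 + sqrt m) / sqrt m) \<ge> s * parK (1/2)) (at_right 0)"
    by (simp add: filterlim_at_top)
  moreover have "eventually (\<lambda>m::real. m \<in> {0<..<1/2}) (at_right 0)"
    by (rule eventually_at_right_real) simp
  ultimately have "eventually (\<lambda>m. ln ((pi/2 + sqrt m) / sqrt m) \<ge> s * parK (1/2)
      \<and> m \<in> {0<..<1/2}) (at_right 0)"
    by eventually_elim simp
  then obtain d :: real where d: "ln ((pi/2 + sqrt d) / sqrt d) \<ge> s * parK (1/2)" "0 < d" "d < 1/2"
    using eventually_happens'[OF trivial_limit_at_right_real[of 0]] by fastforce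
  have pos: "parK d > 0" using parK_pos d by simp
  have "s * parK d \<le> s * parK (1/2)"
    using parK_mono[of d "1/2"] assms d by (intro mult_left_mono) auto
  also have "\<dots> \<le> parK (1 - d)"
    using parK_ge_ln[of "1 - d"] d by simp
  finally have gd: "?g d \<ge> s" using pos by (simp add: field_simps)
  have "?g (1/2) = 1" using parK_pos[of "1/2"] by simp
  then obtain m where m: "d \<le> m" "m \<le> 1/2" "?g m = s"
  proof (atomize_elim, intro IVT2)
    show "\<forall>x. d \<le> x \<and> x \<le> 1/2 \<longrightarrow> isCont ?g x"
    proof (intro allI impI)
      fix x assume x: "d \<le> x \<and> x \<le> 1/2"
      have "isCont (\<lambda>m. parK (1 - m)) x"
        using x d by (intro isCont_o2[OF _ cont]) auto
      then show "isCont ?g x"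
        using x d cont[of x] parK_pos[of x] by (intro continuous_divide) auto
    qed
  qed (use gd assms d in auto)
  have "m \<noteq> 1/2" using m(3) assms \<open>?g (1/2) = 1\<close> by (metis less_irrefl)
  then show ?thesis using m d by (intro exI[of _ m]) auto
qed

text \<open>The definite description has to be justified first: the value sqrt r is attained by
  \<open>parK_ratio_exists\<close>, and only once because the ratio is strictly decreasing.\<close>

lemma lambda_star_bounds:
  assumes "r > 1"
  shows "0 < lambda_star r" "(lambda_star r)\<^sup>2 < 1/2"
proof -
  obtain m where m: "0 < m" "m < 1/2" "parK (1 - m) / parK m = sqrt r"
    using parK_ratio_exists[of "sqrt r"] assms by auto
  have "lambda_star r = sqrt m"
    unfolding lambda_star_def
  proof (rule the_equality)
    show "0 < sqrt m \<and> sqrt m < 1 \<and> ellK' (sqrt m) / ellK (sqrt m) = sqrt r"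
      using m by (simp add: ellK'_parK ellK_parK)
  next
    fix k assume k: "0 < k \<and> k < 1 \<and> ellK' k / ellK k = sqrt r"
    then have "parK (1 - k\<^sup>2) / parK (k\<^sup>2) = sqrt r"
      using ellK'_parK[of k] by (simp add: ellK_parK)
    then have "k\<^sup>2 = m"
      using parK_ratio_less[of m "k\<^sup>2"] parK_ratio_less[of "k\<^sup>2" m] k m
      by (cases "k\<^sup>2" m rule: linorder_cases) (auto simp: power_less_one_iff)
    then show "k = sqrt m" using k by auto
  qed
  then show "0 < lambda_star r" "(lambda_star r)\<^sup>2 < 1/2"
    using m by simp_all
qed

section \<open>The cubic transformation\<close>

lemma hyp21_in_conv_radius:
  fixes a b z :: real
  assumes "a > 0" "b > 0" "\<bar>z\<bar> < 1"
  shows "norm z < fps_conv_radius (hyp21_fps a b)"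
    and "norm z < fps_conv_radius (fps_deriv (hyp21_fps a b))"
    and "norm z < fps_conv_radius (fps_deriv (fps_deriv (hyp21_fps a b)))"
proof -
  let ?u = "hyp21_fps a b"
  have 0: "norm z < fps_conv_radius ?u"
    using assms by (simp add: hyp21_fps_conv_radius)
  also note fps_conv_radius_deriv[of ?u]
  finally have 1: "norm z < fps_conv_radius (fps_deriv ?u)" .
  note 1
  also note fps_conv_radius_deriv[of "fps_deriv ?u"]
  finally show "norm z < fps_conv_radius (fps_deriv (fps_deriv ?u))" .
  show "norm z < fps_conv_radius (fps_deriv ?u)" by (fact 1)
  show "norm z < fps_conv_radius ?u" by (fact 0)
qed

lemma less_fps_conv_radius_mult:
  "e < fps_conv_radius f \<Longrightarrow> e < fps_conv_radius g \<Longrightarrow> e < fps_conv_radius (f * g)"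
  by (rule less_le_trans[OF _ fps_conv_radius_mult]) simp

lemma less_fps_conv_radius_diff:
  "e < fps_conv_radius f \<Longrightarrow> e < fps_conv_radius g \<Longrightarrow> e < fps_conv_radius (f - g)"
  by (rule less_le_trans[OF _ fps_conv_radius_diff]) simp

lemma hyp21_eval_ode:
  fixes a b z :: real
  assumes "a > 0" "b > 0" "\<bar>z\<bar> < 1"
  defines "u \<equiv> hyp21_fps a b"
  shows "z * (1 - z) * eval_fps (fps_deriv (fps_deriv u)) z
    + (1 - (a + b + 1) * z) * eval_fps (fps_deriv u) z = a * b * eval_fps u z"
proof -
  note r = hyp21_in_conv_radius[OF assms(1-3), folded u_def]
  note rs = r less_fps_conv_radius_mult less_fps_conv_radius_diff
  show ?thesis
    using arg_cong[OF hyp21_fps_deriv[of a b, folded u_def], of "\<lambda>f. eval_fps f z"] r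
    by (simp add: eval_fps_add eval_fps_mult eval_fps_diff rs)
qed

text \<open>For x = 4 k^2 (1 - k^2) this is 1728 / j(\<tau>) with Klein's j at \<tau> = (1 + i K'/K)
  / 2, which is why it is negative for small positive x.\<close>

definition cubic_arg :: "real \<Rightarrow> real" where
  "cubic_arg x = - (27 * x / (1 - 4 * x)^3)"

text \<open>The modular source of the prefactor: at the same \<tau>, the Eisenstein series E_4
  equals (2 K / pi)^4 (1 - 4 x), and its fourth root is the hypergeometric function of 1728 /
  j.\<close>

definition cubic_hyp :: "real \<Rightarrow> real" where
  "cubic_hyp x = (1 - 4 * x) powr (-1/4) * eval_fps (hyp21_fps (1/12) (5/12)) (cubic_arg x)"

definition cubic_hyp' :: "real \<Rightarrow> real" where
  "cubic_hyp' x = (1 - 4 * x) powr (-1/4) *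
     (eval_fps (hyp21_fps (1/12) (5/12)) (cubic_arg x) / (1 - 4 * x)
      + - 27 * (1 + 8 * x) / (1 - 4 * x)^4
        * eval_fps (fps_deriv (hyp21_fps (1/12) (5/12))) (cubic_arg x))"

lemma cubic_arg_deriv:
  assumes "x < 1/4"
  shows "(cubic_arg has_real_derivative - 27 * (1 + 8 * x) / (1 - 4 * x)^4) (at x)"
proof -
  define T where "T = 1 - 4 * x"
  have T: "T \<noteq> 0" "x = (1 - T) / 4" using assms by (auto simp: T_def)
  have "(cubic_arg has_real_derivative
      - ((27 * T^3 - 27 * x * (3 * T^2 * (-4))) / (T^3 * T^3))) (at x)"
    unfolding cubic_arg_def[abs_def]
    using T(1) by (auto intro!: derivative_eq_intros simp: T_def)
  \<comment> \<open>After cancelling T^2 the numerator is 27 (T + 12 x), and T + 12 x = 1 + 8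
    x.\<close>
  also have "- ((27 * T^3 - 27 * x * (3 * T^2 * (-4))) / (T^3 * T^3)) = - 27 * (1 + 8 * x) / T^4"
    using T by (simp add: divide_simps) algebra
  finally show ?thesis by (simp add: T_def)
qed

lemma prefactor_deriv:
  fixes x :: real
  assumes "x < 1/4"
  shows "((\<lambda>x. (1 - 4 * x) powr (-1/4)) has_real_derivative
    (1 - 4 * x) powr (-1/4) / (1 - 4 * x)) (at x)"
proof -
  have "((\<lambda>x. (1 - 4 * x) powr (-1/4)) has_real_derivative (1 - 4 * x) powr (-1/4 - 1)) (at x)"
    using assms by (auto intro!: derivative_eq_intros)
  also have "(1 - 4 * x) powr (-1/4 - 1) = (1 - 4 * x) powr (-1/4) / (1 - 4 * x)"
    using assms by (subst powr_diff) simp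
  finally show ?thesis .
qed

lemma cubic_hyp_deriv:
  assumes "x < 1/4" "\<bar>cubic_arg x\<bar> < 1"
  shows "(cubic_hyp has_real_derivative cubic_hyp' x) (at x)"
proof -
  note r = hyp21_in_conv_radius[of "1/12" "5/12", OF _ _ assms(2)]
  have D: "((\<lambda>x. eval_fps (hyp21_fps (1/12) (5/12)) (cubic_arg x)) has_real_derivative
      eval_fps (fps_deriv (hyp21_fps (1/12) (5/12))) (cubic_arg x)
        * (- 27 * (1 + 8 * x) / (1 - 4 * x)^4)) (at x)"
    by (rule DERIV_chain2[OF has_field_derivative_eval_fps cubic_arg_deriv[OF assms(1)]])
      (use r in auto)
  show ?thesis
    unfolding cubic_hyp_def[abs_def]
    by (rule DERIV_cong[OF DERIV_mult[OF prefactor_deriv[OF assms(1)] D]])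
      (simp add: cubic_hyp'_def distrib_left)
qed

text \<open>The equation is the hypergeometric one with parameters 1/4, 1/4; 1. Substituting the
  chain-rule derivatives, the coefficients of U2, U1 and U (\<open>c2\<close>, \<open>c1\<close>,
  \<open>c0\<close>) turn out to be the coefficients of the equation of u at z, all multiplied by
  -27 / T^2.\<close>

lemma cubic_hyp'_deriv:
  assumes "x < 1/4" "\<bar>cubic_arg x\<bar> < 1"
  obtains y where "(cubic_hyp' has_real_derivative y) (at x)"
    "x * (1 - x) * y + (1 - 3/2 * x) * cubic_hyp' x = cubic_hyp x / 16"
proof -
  define T where "T = 1 - 4 * x"
  have T: "T > 0" using assms by (simp add: T_def)
  define z where "z = cubic_arg x"
  let ?u = "hyp21_fps (1/12) (5/12)"
  define U where "U = eval_fps ?u z"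
  define U1 where "U1 = eval_fps (fps_deriv ?u) z"
  define U2 where "U2 = eval_fps (fps_deriv (fps_deriv ?u)) z"
  define s where "s = T powr (-1/4)"
  define p where "p = - 27 * (1 + 8 * x) / T^4"
  define q where "q = - 27 * (24 + 96 * x) / T^5"
  have zT: "z = - (27 * x / T^3)" by (simp add: z_def cubic_arg_def T_def)
  note r = hyp21_in_conv_radius[of "1/12" "5/12", OF _ _ assms(2)]
  have DU: "((\<lambda>x. eval_fps ?u (cubic_arg x)) has_real_derivative U1 * p) (at x)"
    unfolding U1_def z_def p_def T_def
    by (rule DERIV_chain2[OF has_field_derivative_eval_fps cubic_arg_deriv[OF assms(1)]])
      (use r in auto)
  have DU1: "((\<lambda>x. eval_fps (fps_deriv ?u) (cubic_arg x)) has_real_derivative U2 * p) (at x)"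
    unfolding U2_def z_def p_def T_def
    by (rule DERIV_chain2[OF has_field_derivative_eval_fps cubic_arg_deriv[OF assms(1)]])
      (use r in auto)
  have DT: "((\<lambda>x. 1 / (1 - 4 * x)) has_real_derivative 4 / T^2) (at x)"
    using T by (auto intro!: derivative_eq_intros simp: T_def power2_eq_square)
  have Dp: "((\<lambda>x. - 27 * (1 + 8 * x) / (1 - 4 * x)^4) has_real_derivative q) (at x)"
  proof -
    have "((\<lambda>x. - 27 * (1 + 8 * x) / (1 - 4 * x)^4) has_real_derivative
       ((- 27 * 8) * T^4 - (- 27 * (1 + 8 * x)) * (4 * T^3 * (-4))) / (T^4 * T^4)) (at x)"
      using T by (auto intro!: derivative_eq_intros simp: T_def)
    also have "((- 27 * 8) * T^4 - (- 27 * (1 + 8 * x)) * (4 * T^3 * (-4))) / (T^4 * T^4) = q"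
    proof -
      have "((- 27 * 8) * T^4 - (- 27 * (1 + 8 * x)) * (4 * T^3 * (-4))) / (T^4 * T^4)
          = - 27 * (8 * T + 16 * (1 + 8 * x)) / T^5"
        using T by (simp add: field_simps eval_nat_numeral)
      also have "8 * T + 16 * (1 + 8 * x) = 24 + 96 * x" by (simp add: T_def)
      finally show ?thesis by (simp add: q_def)
    qed
    finally show ?thesis .
  qed
  have eq: "cubic_hyp' = (\<lambda>x. (1 - 4 * x) powr (-1/4) * (eval_fps ?u (cubic_arg x) * (1 / (1 - 4 * x))
      + (- 27 * (1 + 8 * x) / (1 - 4 * x)^4) * eval_fps (fps_deriv ?u) (cubic_arg x)))"
    by (simp add: cubic_hyp'_def fun_eq_iff)
  define y where "y = s / T * (U / T + p * U1)
      + s * (U1 * p / T + U * (4 / T^2) + q * U1 + p * (U2 * p))"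
  have D: "(cubic_hyp' has_real_derivative y) (at x)"
    unfolding eq
    by (rule DERIV_cong[OF DERIV_mult[OF prefactor_deriv[OF assms(1)]
          DERIV_add[OF DERIV_mult[OF DU DT] DERIV_mult[OF Dp DU1]]]])
      (simp add: y_def s_def p_def T_def U_def U1_def U2_def z_def mult_ac)
  have c2: "x * (1 - x) * p\<^sup>2 = - 27 / T\<^sup>2 * (z * (1 - z))"
  proof -
    have "1 - z = (T^3 + 27 * x) / T^3"
      using T by (simp add: zT field_simps)
    \<comment> \<open>The double root at x = -1/8 is the critical point of z, where z = 1; it
      supplies the factor (1 + 8 x)^2 that \<open>p\<^sup>2\<close> contains.\<close>
    also have "T^3 + 27 * x = (1 - x) * (1 + 8 * x)\<^sup>2"
      by (simp add: T_def algebra_simps power2_eq_square power3_eq_cube)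
    finally have w: "1 - z = (1 - x) * (1 + 8 * x)\<^sup>2 / T^3" .
    show ?thesis
      unfolding p_def w unfolding zT using T by (simp add: field_simps eval_nat_numeral)
  qed
  have c1: "x * (1 - x) * (2 * p / T + q) + (1 - 3/2 * x) * p = - 27 / T\<^sup>2 * (1 - 3/2 * z)"
  proof -
    have "x * (1 - x) * (2 * p / T + q) + (1 - 3/2 * x) * p
      = (x * (1 - x) * (-54 * (1 + 8 * x) - 27 * (24 + 96 * x)) - 27 * (1 - 3/2 * x) * (1 + 8 * x) * T)
          / T^5"
      using T unfolding p_def q_def by (simp add: field_simps eval_nat_numeral)
    also have "x * (1 - x) * (-54 * (1 + 8 * x) - 27 * (24 + 96 * x))
        - 27 * (1 - 3/2 * x) * (1 + 8 * x) * T = - 27 * (T^3 + 81/2 * x)"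
      by (simp add: T_def field_simps power3_eq_cube)
    also have "- 27 * (T^3 + 81/2 * x) / T^5 = - 27 / T\<^sup>2 * (1 - 3/2 * z)"
      using T unfolding zT by (simp add: field_simps eval_nat_numeral)
    finally show ?thesis .
  qed
  \<comment> \<open>5 / T^2 is the second derivative of T^(-1/4) relative to T^(-1/4), and 5/144 is
    the product of 1/12 and 5/12.\<close>
  have c0: "5 * x * (1 - x) / T\<^sup>2 + (1 - 3/2 * x) / T - 1/16 = 27 / T\<^sup>2 * (5/144)"
  proof -
    have "5 * x * (1 - x) / T\<^sup>2 + (1 - 3/2 * x) / T - 1/16
        = (5 * x * (1 - x) + (1 - 3/2 * x) * T - T\<^sup>2 / 16) / T\<^sup>2"
      using T by (simp add: field_simps power2_eq_square)
    also have "5 * x * (1 - x) + (1 - 3/2 * x) * T - T\<^sup>2 / 16 = 15/16"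
      by (simp add: T_def field_simps power2_eq_square)
    finally show ?thesis by simp
  qed
  have ode: "z * (1 - z) * U2 + (1 - 3/2 * z) * U1 = 5/144 * U"
    using hyp21_eval_ode[of "1/12" "5/12" z] assms by (simp add: U_def U1_def U2_def z_def)
  have "x * (1 - x) * y + (1 - 3/2 * x) * cubic_hyp' x - cubic_hyp x / 16
    = s * ((x * (1 - x) * p\<^sup>2) * U2 + (x * (1 - x) * (2 * p / T + q) + (1 - 3/2 * x) * p) * U1
        + (5 * x * (1 - x) / T\<^sup>2 + (1 - 3/2 * x) / T - 1/16) * U)"
  proof -
    have h': "cubic_hyp' x = s * (U / T + p * U1)" and h: "cubic_hyp x = s * U"
      by (simp_all add: cubic_hyp'_def cubic_hyp_def s_def U_def U1_def z_def T_def p_def)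
    show ?thesis unfolding h h' y_def
      by (simp add: algebra_simps power2_eq_square add_divide_distrib diff_divide_distrib)
  qed
  also have "\<dots> = - 27 * s / T\<^sup>2 * (z * (1 - z) * U2 + (1 - 3/2 * z) * U1 - 5/144 * U)"
    unfolding c0 c1 c2 using T by (simp add: field_simps)
  also have "\<dots> = 0" unfolding ode by simp
  finally show ?thesis using that[OF D] by simp
qed

lemma abs_cubic_arg_mono:
  assumes "0 \<le> y" "y \<le> x" "x < 1/4"
  shows "\<bar>cubic_arg y\<bar> \<le> \<bar>cubic_arg x\<bar>"
proof -
  have "27 * y / (1 - 4 * y)^3 \<le> 27 * x / (1 - 4 * x)^3"
    using assms by (intro frac_le power_mono) auto
  then show ?thesis using assms by (simp add: cubic_arg_def)
qed

text \<open>In the parameter \<open>m\<close>, both \<open>parK\<close> and \<open>cubic_hyp (4 m (1 - m))\<close> solve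
  \<open>(m (1 - m) y')' = y / 4\<close>. Their Wronskian times \<open>m (1 - m)\<close> is therefore constant, and it
  vanishes at \<open>0\<close>, so that the two solutions are proportional.\<close>
lemma parK_eq_cubic_hyp:
  fixes m :: real
  defines "x \<equiv> 4 * m * (1 - m)"
  assumes m: "0 < m" "m < 1/2" and x: "x < 1/4" "\<bar>cubic_arg x\<bar> < 1"
  shows "cubic_hyp x = 2 / pi * parK m"
    and "(1 - 2 * m) * x * cubic_hyp' x = (parE m - (1 - m) * parK m) / pi"
proof -
  define X :: "real \<Rightarrow> real" where "X t = 4 * t * (1 - t)" for t
  define u where "u t = cubic_hyp (X t)" for t
  \<comment> \<open>\<open>R\<close> and \<open>L\<close> are t (1 - t) times the derivatives of
    \<open>u\<close> and \<open>parK\<close>, written without division so that they are defined at t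
    = 0 and vanish there.\<close>
  define R where "R t = (1 - 2 * t) * X t * cubic_hyp' (X t)" for t
  define L where "L t = (parE t - (1 - t) * parK t) / 2" for t
  define W where "W t = u t * L t - R t * parK t" for t
  have X: "X t < 1/4 \<and> \<bar>cubic_arg (X t)\<bar> < 1" if "0 \<le> t" "t \<le> m" for t
  proof -
    \<comment> \<open>Four times this product is \<open>x - X t\<close>; the second factor is
      nonnegative because t \<le> m < 1/2.\<close>
    have "0 \<le> (m - t) * (1 - m - t)" using that m by (intro mult_nonneg_nonneg) auto
    then have "X t \<le> x" by (simp add: X_def x_def algebra_simps)
    moreover have "X t \<ge> 0" using that m by (simp add: X_def)
    ultimately show ?thesis using abs_cubic_arg_mono[of "X t" x] x by auto
  qed
  have DX: "(X has_real_derivative 4 * (1 - 2 * t)) (at t)" for t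
    unfolding X_def[abs_def] by (auto intro!: derivative_eq_intros)
  have Du: "(u has_real_derivative cubic_hyp' (X t) * (4 * (1 - 2 * t))) (at t)"
    if "0 \<le> t" "t \<le> m" for t
    unfolding u_def[abs_def] using X[OF that]
    by (intro DERIV_chain2[OF cubic_hyp_deriv DX]) auto
  have DR: "(R has_real_derivative u t / 4) (at t)" if t: "0 \<le> t" "t \<le> m" for t
  proof -
    obtain y where y: "(cubic_hyp' has_real_derivative y) (at (X t))"
      "X t * (1 - X t) * y + (1 - 3/2 * X t) * cubic_hyp' (X t) = u t / 16"
      using cubic_hyp'_deriv[of "X t"] X[OF t] by (auto simp: u_def)
    have D2: "((\<lambda>t. 1 - 2 * t) has_real_derivative -2) (at t)"
      by (auto intro!: derivative_eq_intros)
    have "(R has_real_derivative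
       ((-2) * X t + (1 - 2 * t) * (4 * (1 - 2 * t))) * cubic_hyp' (X t)
         + (1 - 2 * t) * X t * (y * (4 * (1 - 2 * t)))) (at t)"
      unfolding R_def[abs_def]
      by (rule DERIV_cong[OF DERIV_mult[OF DERIV_mult[OF D2 DX] DERIV_chain2[OF y(1) DX]]])
        (simp add: algebra_simps)
    also have "((-2) * X t + (1 - 2 * t) * (4 * (1 - 2 * t))) * cubic_hyp' (X t)
         + (1 - 2 * t) * X t * (y * (4 * (1 - 2 * t)))
       = ((-2) * X t + 4 * (1 - 2 * t)\<^sup>2) * cubic_hyp' (X t) + 4 * (1 - 2 * t)\<^sup>2 * X t * y"
      by (simp add: power2_eq_square algebra_simps)
    \<comment> \<open>This turns everything into a function of \<open>X t\<close>, so that the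
      equation in x applies; the quadratic substitution multiplies its right side 1/16 by 4.\<close>
    also have "(1 - 2 * t)\<^sup>2 = 1 - X t"
      by (simp add: X_def power2_eq_square algebra_simps)
    also have "((-2) * X t + 4 * (1 - X t)) * cubic_hyp' (X t) + 4 * (1 - X t) * X t * y
      = 4 * (X t * (1 - X t) * y + (1 - 3/2 * X t) * cubic_hyp' (X t))"
      by (simp add: algebra_simps)
    also have "\<dots> = u t / 4" unfolding y(2) by simp
    finally show ?thesis .
  qed
  have cK: "isCont parK t" and cE: "isCont parE t" if "t < 1" for t
    using parK_deriv_integral[OF that] parE_deriv_integral[OF that] by (auto intro: DERIV_isCont)
  have DK: "(parK has_real_derivative L t / (t * (1 - t))) (at t)" if "0 < t" "t < 1" for t
    using parK_deriv[of t] that by (simp add: L_def field_simps)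
  have DL: "(L has_real_derivative parK t / 4) (at t)" if t: "0 < t" "t < 1" for t
  proof -
    have D1: "((\<lambda>t. 1 - t) has_real_derivative -1) (at t)"
      by (auto intro!: derivative_eq_intros)
    have "(L has_real_derivative ((parE t - parK t) / (2 * t)
        - ((-1) * parK t + (1 - t) * (L t / (t * (1 - t))))) / 2) (at t)"
      unfolding L_def[abs_def]
      by (rule DERIV_cong[OF DERIV_cdivide[OF DERIV_diff[OF parE_deriv DERIV_mult[OF D1 DK]]]])
        (use t in \<open>simp_all add: L_def\<close>)
    also have "((parE t - parK t) / (2 * t)
        - ((-1) * parK t + (1 - t) * (L t / (t * (1 - t))))) / 2 = parK t / 4"
      using t by (simp add: L_def field_simps)
    finally show ?thesis .
  qed
  have u'L: "cubic_hyp' (X t) * (4 * (1 - 2 * t)) = R t / (t * (1 - t))" if "0 < t" "t < 1" for t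
    using that by (simp add: R_def X_def)
  have cu: "isCont u t" and cR: "isCont R t" if "0 \<le> t" "t \<le> m" for t
    using Du[OF that] DR[OF that] by (auto intro: DERIV_isCont)
  \<comment> \<open>The derivative formula for \<open>parK\<close> requires t > 0, so the singular
    endpoint is reached only through continuity.\<close>
  have "W t = W 0" if "0 \<le> t" "t \<le> m" for t
  proof (rule DERIV_isconst2[OF m(1) _ _ that])
    show "continuous_on {0..m} W"
      unfolding W_def[abs_def] L_def
      using m by (intro continuous_at_imp_continuous_on ballI continuous_intros cu cR cK cE) auto
  next
    fix t assume t: "0 < t" "t < m"
    have "(W has_real_derivative
       (R t / (t * (1 - t)) * L t + parK t / 4 * u t)
         - (u t / 4 * parK t + L t / (t * (1 - t)) * R t)) (at t)"
      unfolding W_def[abs_def]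
      using DERIV_diff[OF DERIV_mult[OF Du DL] DERIV_mult[OF DR DK], of t] t m u'L[of t] by simp
    then show "(W has_real_derivative 0) (at t)" by simp
  qed
  also have "W 0 = 0" by (simp add: W_def L_def R_def X_def)
  finally have W: "u t * L t = R t * parK t" if "0 \<le> t" "t \<le> m" for t
    using that unfolding W_def by simp
  have pos: "parK t > 0" if "0 \<le> t" "t \<le> m" for t
    using that m parK_pos by simp
  \<comment> \<open>The vanishing Wronskian makes the quotient constant; its value at 0, namely 1 /
    (pi/2), is the origin of the factor 2 / pi.\<close>
  have "u m / parK m = u 0 / parK 0"
  proof (rule DERIV_isconst_end[OF m(1)])
    show "continuous_on {0..m} (\<lambda>t. u t / parK t)"
      using m by (intro continuous_at_imp_continuous_on ballI continuous_intros cu cK)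
        (auto dest!: pos)
  next
    fix t assume t: "0 < t" "t < m"
    then have "((\<lambda>t. u t / parK t) has_real_derivative
        (R t / (t * (1 - t)) * parK t - u t * (L t / (t * (1 - t)))) / (parK t * parK t)) (at t)"
      using DERIV_divide[OF Du[of t] DK[of t]] m u'L[of t] pos[of t] by simp
    also have "R t / (t * (1 - t)) * parK t - u t * (L t / (t * (1 - t))) = 0"
      using W[of t] t m by (simp add: field_simps)
    finally show "((\<lambda>t. u t / parK t) has_real_derivative 0) (at t)" by simp
  qed
  moreover have "u 0 = 1"
    by (simp add: u_def X_def cubic_hyp_def cubic_arg_def eval_fps_at_0 hyp21_fps_def)
  ultimately have um: "u m = 2 / pi * parK m"
    using pos[of m] m by (simp add: field_simps)
  have Xm: "X m = x" by (simp add: X_def x_def)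
  show "cubic_hyp x = 2 / pi * parK m"
    using um by (simp add: u_def Xm)
  \<comment> \<open>The vanishing Wronskian at m, with the first claim inserted for
    \<open>u m\<close>, gives the derivative relation after cancelling K.\<close>
  have "R m * parK m = 2 / pi * L m * parK m"
    using W[of m] m um by (simp add: mult_ac)
  then have "R m = 2 / pi * L m" using pos[of m] m(1) by (subst (asm) mult_right_cancel) auto
  then show "(1 - 2 * m) * x * cubic_hyp' x = (parE m - (1 - m) * parK m) / pi"
    by (simp add: R_def L_def Xm divide_simps)
qed

section \<open>Evaluation of the series\<close>

lemma hyp21_square_sums:
  fixes a b z c d :: real
  assumes "a + b = 1/2" "a > 0" "b > 0" "\<bar>z\<bar> < 1"
  defines "u \<equiv> hyp21_fps a b"
  shows "(\<lambda>n. pochhammer (2*a) n * pochhammer (1/2) n * pochhammer (2*b) n / (fact n)^3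
      * z^n * (c + d * real n)) sums
    (c * (eval_fps u z)\<^sup>2 + d * (2 * z * eval_fps u z * eval_fps (fps_deriv u) z))"
proof -
  define v where "v = u * u"
  have v: "v $ n = pochhammer (2*a) n * pochhammer (1/2) n * pochhammer (2*b) n / (fact n)^3" for n
    using hyp21_clausen[OF assms(1)] by (simp add: v_def u_def)
  note r = hyp21_in_conv_radius[OF assms(2-4), folded u_def]
  note rs = r less_fps_conv_radius_mult
  \<comment> \<open>The weight n on the coefficients is the Euler operator applied to the square,
    hence the value 2 z u u'.\<close>
  have tv: "fps_theta v = fps_const 2 * (fps_X * (u * fps_deriv u))"
    by (simp add: fps_theta_def v_def fps_numeral_fps_const flip: mult_2)
  have "(\<lambda>n. v $ n * z^n) sums (eval_fps u z)\<^sup>2"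
    using sums_eval_fps[of z v] r by (simp add: v_def eval_fps_mult power2_eq_square rs)
  moreover have "(\<lambda>n. real n * v $ n * z^n) sums (2 * z * eval_fps u z * eval_fps (fps_deriv u) z)"
    using sums_eval_fps[of z "fps_theta v"] unfolding fps_theta_nth unfolding tv
    using r by (simp add: eval_fps_mult rs mult.assoc)
  ultimately have "(\<lambda>n. c * (v $ n * z^n) + d * (real n * v $ n * z^n)) sums
      (c * (eval_fps u z)\<^sup>2 + d * (2 * z * eval_fps u z * eval_fps (fps_deriv u) z))"
    by (intro sums_add sums_mult)
  then show ?thesis
    unfolding v by (simp add: algebra_simps add_divide_distrib)
qed

text \<open>For 1/4 < x \<le> 1 the cube (1 - 4 x)^3 is negative, and then z \<ge> 1 amounts to (1 -
  x) (1 + 8 x)^2 \<ge> 0.\<close>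

lemma cubic_arg_less_1_imp:
  assumes "x \<le> 1" "4 * x \<noteq> 1" "\<bar>cubic_arg x\<bar> < 1"
  shows "x < 1/4"
proof (rule ccontr)
  assume "\<not> x < 1/4"
  then have x: "x > 1/4" using assms by simp
  have "0 \<le> (1 - x) * (1 + 8 * x)\<^sup>2" using assms by simp
  also have "\<dots> = (1 - 4 * x)^3 + 27 * x"
    by (simp add: power2_eq_square power3_eq_cube algebra_simps)
  finally have "- ((1 - 4 * x)^3) \<le> 27 * x" by simp
  moreover have "(1 - 4 * x)^3 < 0" using x by (simp add: power3_eq_cube mult_pos_neg zero_less_mult_iff mult_less_0_iff)
  ultimately have "cubic_arg x \<ge> 1" by (simp add: cubic_arg_def field_simps)
  then show False using assms by simp
qed

(* The hypothesis 4 * x \<noteq> 1 says that z is defined. It fails at r = 3 (x = 1/4), where division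
   by zero would give z = 0 and make \<bar>z\<bar> < 1 hold vacuously. *)
theorem mainTheorem3:
  fixes r x z a b :: real
  assumes "r > 1"
    and "x = 4 * ((lambda_star r)^2 - (lambda_star r)^4)"
    and "4 * x \<noteq> 1"
    and "z = - (27 * x / (1 - 4 * x)^3)"
    and "a = (2 * (1 - 4 * x) * elliptic_alpha r + (4 * x - 1 + sqrt (1 - x)) * sqrt r)
               / (2 * sqrt ((1 - 4 * x)^3))"
    and "b = (1 + 8 * x) * sqrt (1 - x) * sqrt r / sqrt ((1 - 4 * x)^3)"
    and "\<bar>z\<bar> < 1"
  shows "(\<lambda>n. pochhammer (1/6) n * pochhammer (1/2) n * pochhammer (5/6) n / (fact n)^3
              * z^n * (a + b * real n)) sums (1 / pi)"
proof -
  define m where "m = (lambda_star r)\<^sup>2"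
  have m: "0 < m" "m < 1/2"
    using lambda_star_bounds[OF assms(1)] by (auto simp: m_def)
  have xm: "x = 4 * m * (1 - m)"
    unfolding assms(2) m_def by (simp add: algebra_simps flip: power_mult power_add)
  have x1: "1 - x = (1 - 2 * m)\<^sup>2"
    by (simp add: xm power2_eq_square algebra_simps)
  then have "x \<le> 1" by (metis diff_ge_0_iff_ge zero_le_power2)
  have z: "z = cubic_arg x" by (simp add: assms(4) cubic_arg_def)
  have x: "0 < x" "x < 1/4" "\<bar>cubic_arg x\<bar> < 1"
    using cubic_arg_less_1_imp[of x] \<open>x \<le> 1\<close> assms(3,7) m z by (auto simp: xm)
  define T where "T = 1 - 4 * x"
  have T: "T > 0" using x by (simp add: T_def)
  let ?u = "hyp21_fps (1/12) (5/12)"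
  define U where "U = eval_fps ?u z"
  define U1 where "U1 = eval_fps (fps_deriv ?u) z"
  define s where "s = T powr (-1/4)"
  define w where "w = sqrt T"
  define K where "K = parK m"
  define E where "E = parE m"
  define R where "R = sqrt r"
  have K: "K > 0" using parK_pos m by (simp add: K_def)
  have w: "w > 0" "w\<^sup>2 = T" using T by (simp_all add: w_def)
  have "s ^ 2 = T powr (-1/2)"
    by (simp add: s_def power2_eq_square flip: powr_add)
  also have "\<dots> = 1 / w"
    using T by (simp add: w_def powr_minus powr_half_sqrt field_simps)
  finally have s: "s > 0" "s\<^sup>2 = 1 / w" using T by (simp_all add: s_def)
  have k1: "s * U = 2 / pi * K"
    using parK_eq_cubic_hyp(1)[of m] m x
    by (simp add: cubic_hyp_def s_def U_def z T_def K_def flip: xm)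
  have k2: "(1 - 2 * m) * x * (s * (U / T + - 27 * (1 + 8 * x) / T^4 * U1)) = (E - (1 - m) * K) / pi"
    using parK_eq_cubic_hyp(2)[of m] m x
    by (simp add: cubic_hyp'_def s_def U_def U1_def z T_def K_def E_def flip: xm)
  have UU: "U\<^sup>2 = 4 * w * K\<^sup>2 / pi\<^sup>2"
  proof -
    have "s\<^sup>2 * U\<^sup>2 = 4 * K\<^sup>2 / pi\<^sup>2"
      using arg_cong[OF k1, of "\<lambda>t. t\<^sup>2"] by (simp add: power_mult_distrib power_divide)
    then show ?thesis using w by (simp add: s field_simps)
  qed
  \<comment> \<open>The factors (1 - 2 m) (1 + 8 x) are those with which U1 occurs in
    \<open>k2\<close>, and b contains exactly them; multiplying \<open>k2\<close> by 2 U T / s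
    isolates the product with U1.\<close>
  have zU: "(1 - 2 * m) * (1 + 8 * x) * (2 * z * U * U1)
      = 4 * w * T * K * (E - (1 - m) * K) / pi\<^sup>2 - 8 * x * w * (1 - 2 * m) * K\<^sup>2 / pi\<^sup>2"
  proof -
    have "(1 - 2 * m) * (1 + 8 * x) * (2 * z * U * U1)
       = 2 * U * T / s * ((1 - 2 * m) * x * (s * (U / T + - 27 * (1 + 8 * x) / T^4 * U1)))
           - 2 * x * (1 - 2 * m) * U\<^sup>2"
      using T s(1) unfolding assms(4) T_def[symmetric]
      by (simp add: field_simps eval_nat_numeral)
    also have "2 * U * T / s = 2 * T * (s * U) / s\<^sup>2"
      using s(1) by (simp add: power2_eq_square)
    also have "\<dots> = 4 * T * K * w / pi"
      unfolding k1 s(2) by simp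
    finally show ?thesis
      unfolding k2 UU by (simp add: power2_eq_square algebra_simps)
  qed
  have sqT: "sqrt (T^3) = w^3"
    by (simp add: w_def real_sqrt_power)
  \<comment> \<open>Here m < 1/2 decides the sign of the root.\<close>
  have sqx: "sqrt (1 - x) = 1 - 2 * m"
    using m by (simp add: x1)
  have \<alpha>: "elliptic_alpha r = pi / (4 * K\<^sup>2) - R * (E / K - 1)"
    by (simp add: elliptic_alpha_def Let_def ellK_parK ellE_parE K_def E_def R_def m_def)
  have a: "a = (2 * T * (pi / (4 * K\<^sup>2) - R * (E / K - 1)) + (1 - 2 * m - T) * R) / (2 * w^3)"
    unfolding assms(5) \<alpha> sqx sqT[symmetric] by (simp add: T_def R_def algebra_simps)
  have b: "b = (1 - 2 * m) * (1 + 8 * x) * R / w^3"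
    unfolding assms(6) sqx sqT[symmetric] by (simp add: T_def R_def)
  \<comment> \<open>The target 1 / pi is the contribution of pi / (4 K^2) in alpha: the K^2 of
    \<open>UU\<close> cancels it, and w^2 = T removes the radicals.\<close>
  have aU: "a * U\<^sup>2 = 1 / pi - 4 * R * K * (E - K) / pi\<^sup>2 + 2 * (1 - 2 * m - T) * R * K\<^sup>2 / (T * pi\<^sup>2)"
    unfolding a UU w(2)[symmetric] using w(1) K by (simp add: field_simps eval_nat_numeral)
  have bU: "b * (2 * z * U * U1)
      = R * (4 * K * (E - (1 - m) * K) / pi\<^sup>2 - 8 * x * (1 - 2 * m) * K\<^sup>2 / (T * pi\<^sup>2))"
  proof -
    have "b * (2 * z * U * U1) = R / w^3 * ((1 - 2 * m) * (1 + 8 * x) * (2 * z * U * U1))"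
      unfolding b by simp
    also have "\<dots> = R * (4 * K * (E - (1 - m) * K) / pi\<^sup>2 - 8 * x * (1 - 2 * m) * K\<^sup>2 / (T * pi\<^sup>2))"
      unfolding zU w(2)[symmetric] using w(1) by (simp add: field_simps eval_nat_numeral)
    finally show ?thesis .
  qed
  have "a * U\<^sup>2 + b * (2 * z * U * U1)
    = 1 / pi + R * K\<^sup>2 / pi\<^sup>2 * (4 * m + 2 * ((1 - 2 * m - T) - 4 * x * (1 - 2 * m)) / T)"
    unfolding aU bU using T by (simp add: field_simps power2_eq_square)
  \<comment> \<open>E has cancelled between \<open>aU\<close> and \<open>bU\<close>. In what
    remains, collecting the terms with 1 - 2 m gives (1 - 2 m) T - T, which exactly offsets the term
    4 m.\<close>
  also have "(1 - 2 * m - T) - 4 * x * (1 - 2 * m) = - 2 * m * T"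
    by (simp add: T_def algebra_simps)
  also have "4 * m + 2 * (- 2 * m * T) / T = 0"
    using T by simp
  finally have "a * U\<^sup>2 + b * (2 * z * U * U1) = 1 / pi" by simp
  then show ?thesis
    using hyp21_square_sums[of "1/12" "5/12" z a b] assms(7) by (simp add: U_def U1_def)
qed

end
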